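(* Let $D$ be a diagram with nonempty columns $c_1<c_2<\cdots<c_n$, and for $i\in[n]$ let $(r_i,c_i)$ be the topmost cell in column $c_i$ of $D$. Then \[\mathrm{mc}(D)=\sum_{i=1}^n\bigl[r_i-h(D,c_i)\bigr].\]
   Context: A diagram is a finite subset $D\subset\mathbb{Z}_{>0}\times\mathbb{Z}_{>0}$; an element $(r,c)\in D$ is a cell in row $r$, column $c$. For $r\in\mathbb{Z}_{>0}$, the Kohnert move at row $r$: if row $r$ of $D$ is empty, $\mathcal{K}(D,r)=D$; otherwise let $(r,c)$ be the cell of row $r$ with largest column index; if some $r'<r$ has $(r',c)\notin D$, let $r'$ be the largest such and $\mathcal{K}(D,r)=(D\setminus\{(r,c)\})\cup\{(r',c)\}$; otherwise $\mathcal{K}(D,r)=D$. The move is nontrivial if $\mathcal{K}(D,r)\ne D$. $\mathrm{KD}(D)$ is the set of diagrams obtainable from $D$ by finite (possibly empty) sequences of Kohnert moves; $\mathrm{Min}(D)=\{\tilde D\in\mathrm{KD}(D):\mathcal{K}(\tilde D,r)=\tilde D\ \forall r\}$. $\mathrm{mc}(D)$ is the minimum, over all $\tilde D\in\mathrm{Min}(D)$ and all sequences $(r_1,\dots,r_m)$ such that with $D_0=D$, $D_i=\mathcal{K}(D_{i-1},r_i)$ each move is nontrivial and $D_m=\tilde D$, of the length $m$. For a nonempty column $c$ of $D$: let $m_c$ be the number of cells in column $c$, $M$ the maximum number of cells in a column strictly to the right of $c$ (with $M=0$ if there is none), and $r$ the row of the topmost cell of column $c$; define $h(D,c)=r$ if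 $M\ge r$, $h(D,c)=m_c$ if $m_c\ge M$, and $h(D,c)=M$ if $r>M>m_c$. *)

theory Defs
  imports Main
begin

type_synonym cell = "nat \<times> nat"

text \<open>A cell is a pair (row, column); rows are numbered from bottom to top, starting at 1,
  so the topmost cell of a column is the one with the largest row index.\<close>

definition diagram :: "cell set \<Rightarrow> bool" where
  "diagram D \<longleftrightarrow> finite D \<and> D \<subseteq> {0<..} \<times> {0<..}"

definition row_cols :: "cell set \<Rightarrow> nat \<Rightarrow> nat set" where
  "row_cols D r = {c. (r, c) \<in> D}"

definition column_rows :: "cell set \<Rightarrow> nat \<Rightarrow> nat set" where
  "column_rows D c = {r. (r, c) \<in> D}"

definition nonempty_columns :: "cell set \<Rightarrow> nat set" where
  "nonempty_columns D = {c. column_rows D c \<noteq> {}}"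

definition kohnert_move :: "cell set \<Rightarrow> nat \<Rightarrow> cell set" where
  "kohnert_move D r =
    (if row_cols D r = {} then D
     else let c = Max (row_cols D r); S = {r'. 0 < r' \<and> r' < r \<and> (r', c) \<notin> D}
          in if S = {} then D else insert (Max S, c) (D - {(r, c)}))"

inductive_set KD :: "cell set \<Rightarrow> cell set set" for D :: "cell set" where
  KD_refl: "D \<in> KD D"
| KD_step: "E \<in> KD D \<Longrightarrow> 0 < r \<Longrightarrow> kohnert_move E r \<in> KD D"

definition minimal_KD :: "cell set \<Rightarrow> cell set set" where
  "minimal_KD D = {E \<in> KD D. \<forall>r>0. kohnert_move E r = E}"

fun nontrivial_moves :: "cell set \<Rightarrow> nat list \<Rightarrow> cell set \<Rightarrow> bool" where
  "nontrivial_moves D [] E \<longleftrightarrow> E = D"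
| "nontrivial_moves D (r # rs) E \<longleftrightarrow>
     0 < r \<and> kohnert_move D r \<noteq> D \<and> nontrivial_moves (kohnert_move D r) rs E"

definition mc :: "cell set \<Rightarrow> nat" where
  "mc D = (LEAST m. \<exists>E \<in> minimal_KD D. \<exists>rs. nontrivial_moves D rs E \<and> length rs = m)"

definition top_row :: "cell set \<Rightarrow> nat \<Rightarrow> nat" where
  "top_row D c = Max (column_rows D c)"

definition right_max :: "cell set \<Rightarrow> nat \<Rightarrow> nat" where
  "right_max D c = Max (insert 0 ((\<lambda>c'. card (column_rows D c')) ` {c' \<in> nonempty_columns D. c < c'}))"

text \<open>The three cases cover everything, and where the first two overlap they agree,
  since a column with topmost row \<open>r\<close> has at most \<open>r\<close> cells.\<close>

definition h :: "cell set \<Rightarrow> nat \<Rightarrow> nat" where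
  "h D c =
    (let m = card (column_rows D c); M = right_max D c; r = top_row D c
     in if r \<le> M then r else if M \<le> m then m else M)"

text \<open>The minimum in \<^const>\<open>mc\<close> is taken over a nonempty set: each nontrivial move lowers
  the sum of the row indices.\<close>

lemma kohnert_move_decreases:
  assumes "finite D" "kohnert_move D r \<noteq> D"
  shows "finite (kohnert_move D r)" "sum fst (kohnert_move D r) < sum fst D"
proof -
  define c where "c = Max (row_cols D r)"
  define S where "S = {r'. 0 < r' \<and> r' < r \<and> (r', c) \<notin> D}"
  have ne: "row_cols D r \<noteq> {}" "S \<noteq> {}"
    and eq: "kohnert_move D r = insert (Max S, c) (D - {(r, c)})"
    using assms(2) by (auto simp: kohnert_move_def Let_def c_def S_def split: if_splits)
  have "row_cols D r \<subseteq> snd ` D"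
    by (force simp: row_cols_def)
  then have "c \<in> row_cols D r"
    unfolding c_def using Max_in ne(1) assms(1) by (meson finite_imageI finite_subset)
  then have rc: "(r, c) \<in> D"
    by (simp add: row_cols_def)
  have "finite S" by (simp add: S_def)
  then have "Max S \<in> S" using Max_in ne(2) by blast
  then have S: "Max S < r" "(Max S, c) \<notin> D" by (auto simp: S_def)
  show "finite (kohnert_move D r)" using eq assms(1) by simp
  have "sum fst (kohnert_move D r) = Max S + sum fst (D - {(r, c)})"
    using S assms(1) by (simp add: eq)
  also have "\<dots> < r + sum fst (D - {(r, c)})" using S by simp
  also have "\<dots> = sum fst D" using sum.remove[OF assms(1) rc, of fst] by simp
  finally show "sum fst (kohnert_move D r) < sum fst D" .
qed

lemma KD_trans: "F \<in> KD E \<Longrightarrow> E \<in> KD D \<Longrightarrow> F \<in> KD D"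
  by (induction rule: KD.induct) (auto intro: KD.intros)

lemma mc_wellfounded:
  assumes "finite D"
  shows "\<exists>E \<in> minimal_KD D. \<exists>rs. nontrivial_moves D rs E"
  using assms
proof (induction "sum fst D" arbitrary: D rule: less_induct)
  case less
  show ?case
  proof (cases "\<forall>r>0. kohnert_move D r = D")
    case True
    then have "D \<in> minimal_KD D" by (simp add: minimal_KD_def KD_refl)
    moreover have "nontrivial_moves D [] D" by simp
    ultimately show ?thesis by blast
  next
    case False
    then obtain r where r: "0 < r" "kohnert_move D r \<noteq> D" by blast
    obtain E rs where E: "E \<in> minimal_KD (kohnert_move D r)"
      "nontrivial_moves (kohnert_move D r) rs E"
      using less.hyps kohnert_move_decreases[OF less.prems r(2)] by blast
    have "E \<in> minimal_KD D"
      using E(1) KD_trans[OF _ KD_step[OF KD_refl r(1)]] by (auto simp: minimal_KD_def)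
    moreover have "nontrivial_moves D (r # rs) E" using r E(2) by simp
    ultimately show ?thesis by blast
  qed
qed

end

theory Submission
  imports Defs
begin

text \<open>Let \<open>b(c)\<close> be the largest number of cells in a column weakly to the right of \<open>c\<close>. Moves
  preserve \<open>b\<close>, and \<open>r - h(D, c)\<close> is the amount by which the topmost row \<open>r\<close> of column \<open>c\<close>
  exceeds \<open>b(c)\<close>. The total excess drops by at most one in each move, since moving the topmost
  cell of a column lowers the top by exactly one and any other move leaves all tops unchanged.
  If the excess is positive, the topmost cell of the rightmost column with positive excess can be
  moved, lowering the excess by one; if the excess is zero, then no move is possible.
  Hence the excess is the minimal number of moves.\<close>

definition height_bound :: "cell set \<Rightarrow> nat \<Rightarrow> nat" where
  "height_bound D c = max (card (column_rows D c)) (right_max D c)"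

text \<open>Subtraction on \<open>nat\<close> truncates, so a column whose top does not exceed its
  bound contributes 0. For a diagram this is exactly the case where \<open>h D c\<close> is the top
  row itself.\<close>

definition excess :: "cell set \<Rightarrow> nat" where
  "excess D = (\<Sum>c \<in> nonempty_columns D. top_row D c - height_bound D c)"

section \<open>Finiteness, top rows and full columns\<close>

lemma finite_column_rows: "diagram D \<Longrightarrow> finite (column_rows D c)"
  by (rule finite_subset[of _ "fst ` D"]) (force simp: column_rows_def diagram_def)+

lemma finite_row_cols: "diagram D \<Longrightarrow> finite (row_cols D r)"
  by (rule finite_subset[of _ "snd ` D"]) (force simp: row_cols_def diagram_def)+

lemma finite_nonempty_columns: "diagram D \<Longrightarrow> finite (nonempty_columns D)"
  by (rule finite_subset[of _ "snd ` D"])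
    (force simp: nonempty_columns_def column_rows_def diagram_def)+

lemma top_row_in: "diagram D \<Longrightarrow> c \<in> nonempty_columns D \<Longrightarrow> (top_row D c, c) \<in> D"
  using Max_in[OF finite_column_rows, of D c]
  by (auto simp: nonempty_columns_def column_rows_def top_row_def)

lemma le_top_row: "diagram D \<Longrightarrow> (r, c) \<in> D \<Longrightarrow> r \<le> top_row D c"
  unfolding top_row_def by (rule Max_ge[OF finite_column_rows]) (auto simp: column_rows_def)

lemma column_rows_subset: "diagram D \<Longrightarrow> column_rows D c \<subseteq> {1..top_row D c}"
  using le_top_row by (fastforce simp: column_rows_def diagram_def)

lemma card_column_rows_le_top_row: "diagram D \<Longrightarrow> card (column_rows D c) \<le> top_row D c"
  using card_mono[OF _ column_rows_subset, of D c] by simp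

lemma column_full:
  assumes "diagram D" "top_row D c \<le> card (column_rows D c)"
  shows "column_rows D c = {1..top_row D c}"
  using assms by (intro card_subset_eq column_rows_subset)
    (simp_all add: card_column_rows_le_top_row le_antisym)

section \<open>Column sizes to the right and the height bound\<close>

lemma right_max_ge:
  assumes "diagram D" "c' \<in> nonempty_columns D" "c < c'"
  shows "card (column_rows D c') \<le> right_max D c"
  unfolding right_max_def using assms finite_nonempty_columns[OF assms(1)]
  by (intro Max_ge) auto

lemma right_max_cases:
  assumes "diagram D"
  obtains "right_max D c = 0"
  | c' where "c' \<in> nonempty_columns D" "c < c'" "right_max D c = card (column_rows D c')"
proof -
  have "right_max D c \<in>
      insert 0 ((\<lambda>c'. card (column_rows D c')) ` {c' \<in> nonempty_columns D. c < c'})"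
    unfolding right_max_def using finite_nonempty_columns[OF assms] by (intro Max_in) auto
  then show thesis using that by auto
qed

text \<open>Column \<open>c'\<close> and every column to its right lie strictly to the right of
  \<open>c\<close>, so all their sizes already compete in \<open>right_max D c\<close>.\<close>

lemma height_bound_antimono:
  assumes "diagram D" "c' \<in> nonempty_columns D" "c < c'"
  shows "height_bound D c' \<le> height_bound D c"
proof -
  have "right_max D c' \<le> right_max D c"
    by (rule right_max_cases[OF assms(1), of c'])
      (use right_max_ge[OF assms(1)] assms(3) in \<open>auto intro: less_trans\<close>)
  then show ?thesis
    using right_max_ge[OF assms] by (auto simp: height_bound_def)
qed

text \<open>The three cases of \<open>h\<close> collapse into one formula because a column has at
  most as many cells as its top row index.\<close>

lemma h_eq: "diagram D \<Longrightarrow> h D c = min (top_row D c) (height_bound D c)"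
  using card_column_rows_le_top_row[of D c] by (auto simp: h_def height_bound_def Let_def)

section \<open>Effect of a Kohnert move on columns and tops\<close>

lemma kohnert_moveE:
  assumes "diagram D" "kohnert_move D r \<noteq> D"
  obtains s c where "(r, c) \<in> D" "(s, c) \<notin> D" "0 < s" "s < r"
    "\<And>c'. (r, c') \<in> D \<Longrightarrow> c' \<le> c"
    "\<And>t. s < t \<Longrightarrow> t < r \<Longrightarrow> (t, c) \<in> D"
    "kohnert_move D r = insert (s, c) (D - {(r, c)})"
proof -
  define c where "c = Max (row_cols D r)"
  define S where "S = {r'. 0 < r' \<and> r' < r \<and> (r', c) \<notin> D}"
  have ne: "row_cols D r \<noteq> {}" "S \<noteq> {}"
    and eq: "kohnert_move D r = insert (Max S, c) (D - {(r, c)})"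
    using assms(2) by (auto simp: kohnert_move_def Let_def c_def S_def split: if_splits)
  have fin: "finite S" by (simp add: S_def)
  have c: "(r, c) \<in> D" "\<And>c'. (r, c') \<in> D \<Longrightarrow> c' \<le> c"
    using Max_in[OF finite_row_cols ne(1)] Max_ge[OF finite_row_cols] assms(1)
    by (auto simp: c_def row_cols_def)
  have s: "0 < Max S" "Max S < r" "(Max S, c) \<notin> D"
    using Max_in[OF fin ne(2)] by (simp_all add: S_def)
  have gap: "(t, c) \<in> D" if "Max S < t" "t < r" for t
  proof (rule ccontr)
    assume "(t, c) \<notin> D"
    with that have "t \<in> S" by (auto simp: S_def)
    with Max_ge[OF fin] that(1) show False by (simp add: leD)
  qed
  show thesis by (rule that[OF c(1) s(3,1,2) c(2) gap eq])
qed

lemma kohnert_move_nontrivial: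
  assumes "diagram D" "(r, c) \<in> D" "\<And>c'. (r, c') \<in> D \<Longrightarrow> c' \<le> c"
    "0 < s" "s < r" "(s, c) \<notin> D"
  shows "kohnert_move D r \<noteq> D"
proof -
  have c: "Max (row_cols D r) = c"
    using assms by (intro Max_eqI finite_row_cols) (auto simp: row_cols_def)
  define S where "S = {r'. 0 < r' \<and> r' < r \<and> (r', c) \<notin> D}"
  have ne: "row_cols D r \<noteq> {}" "S \<noteq> {}" using assms by (auto simp: row_cols_def S_def)
  have "kohnert_move D r = insert (Max S, c) (D - {(r, c)})"
    unfolding kohnert_move_def Let_def c S_def[symmetric] using ne by simp
  moreover have "Max S \<in> S" using ne(2) by (intro Max_in) (auto simp: S_def)
  ultimately show ?thesis by (auto simp: S_def)
qed

lemma diagram_kohnert_move: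
  assumes "diagram D" shows "diagram (kohnert_move D r)"
proof (cases "kohnert_move D r = D")
  case False
  show ?thesis
    by (rule kohnert_moveE[OF assms False]) (use assms in \<open>auto simp: diagram_def\<close>)
qed (simp add: assms)

lemma column_rows_move:
  "column_rows (insert (s, c) (D - {(r, c)})) c' =
    (if c' = c then insert s (column_rows D c - {r}) else column_rows D c')"
  by (auto simp: column_rows_def)

text \<open>A move takes a cell to a vacant position of the same column.\<close>

lemma card_column_rows_kohnert_move:
  assumes "diagram D"
  shows "card (column_rows (kohnert_move D r) c) = card (column_rows D c)"
proof (cases "kohnert_move D r = D")
  case False
  obtain s c' where m: "(r, c') \<in> D" "(s, c') \<notin> D"
      "kohnert_move D r = insert (s, c') (D - {(r, c')})"
    by (rule kohnert_moveE[OF assms False]) blast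
  have "r \<in> column_rows D c'" "s \<notin> column_rows D c'"
    using m by (auto simp: column_rows_def)
  then have "card (insert s (column_rows D c' - {r})) = card (column_rows D c')"
    using finite_column_rows[OF assms, of c'] card.remove[of "column_rows D c'" r] by simp
  then show ?thesis by (simp add: m(3) column_rows_move)
qed simp

lemma nonempty_columns_kohnert_move:
  assumes "diagram D"
  shows "nonempty_columns (kohnert_move D r) = nonempty_columns D"
proof -
  have "column_rows (kohnert_move D r) c = {} \<longleftrightarrow> column_rows D c = {}" for c
    using card_column_rows_kohnert_move[OF assms, of r c] finite_column_rows[OF assms, of c]
      finite_column_rows[OF diagram_kohnert_move[OF assms], of r c]
    by (metis card_eq_0_iff)
  then show ?thesis by (simp add: nonempty_columns_def)
qed

lemma height_bound_kohnert_move: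
  "diagram D \<Longrightarrow> height_bound (kohnert_move D r) c = height_bound D c"
  by (simp add: height_bound_def right_max_def card_column_rows_kohnert_move
      nonempty_columns_kohnert_move)

text \<open>The moved cell jumps only over occupied rows. If it was the top of its column, then row
  \<open>r - 1\<close> is either where it lands or was occupied before, so the top drops by exactly
  one however far the cell falls. If it was not the top, the top cell stays and the landing row lies
  below it.\<close>

lemma top_row_kohnert_move:
  assumes D: "diagram D" and nt: "kohnert_move D r \<noteq> D" and rc: "(r, c) \<in> D"
    and right: "\<And>c'. (r, c') \<in> D \<Longrightarrow> c' \<le> c"
  shows "top_row (kohnert_move D r) c' =
    (if c' = c \<and> r = top_row D c then top_row D c - 1 else top_row D c')"
proof -
  obtain s c'' where m: "(r, c'') \<in> D" "(s, c'') \<notin> D" "0 < s" "s < r"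
      "\<And>c'. (r, c') \<in> D \<Longrightarrow> c' \<le> c''" "\<And>t. s < t \<Longrightarrow> t < r \<Longrightarrow> (t, c'') \<in> D"
      "kohnert_move D r = insert (s, c'') (D - {(r, c'')})"
    by (rule kohnert_moveE[OF D nt]) blast
  have [simp]: "c'' = c" using m(1,5) rc right by (simp add: le_antisym)
  have cols: "column_rows (kohnert_move D r) c' =
      (if c' = c then insert s (column_rows D c - {r}) else column_rows D c')" for c'
    by (simp add: m(7) column_rows_move)
  have fin: "finite (insert s (column_rows D c - {r}))"
    using finite_column_rows[OF D] by simp
  have "Max (insert s (column_rows D c - {r})) = top_row D c - 1" if r: "r = top_row D c"
  proof (intro Max_eqI fin)
    show "top_row D c - 1 \<in> insert s (column_rows D c - {r})"
    proof (cases "s = r - 1")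
      case False
      then have "(r - 1, c) \<in> D" "r - 1 \<noteq> r" using m(4) m(6)[of "r - 1"] by auto
      then show ?thesis using r by (auto simp: column_rows_def)
    qed (use r in simp)
    fix y assume "y \<in> insert s (column_rows D c - {r})"
    then have "y < r" using m(4) le_top_row[OF D, of y c] r by (auto simp: column_rows_def)
    then show "y \<le> top_row D c - 1" using r by simp
  qed
  moreover have "Max (insert s (column_rows D c - {r})) = top_row D c" if r: "r \<noteq> top_row D c"
  proof (intro Max_eqI fin)
    have "c \<in> nonempty_columns D" using rc by (auto simp: nonempty_columns_def column_rows_def)
    then show "top_row D c \<in> insert s (column_rows D c - {r})"
      using top_row_in[OF D] r by (auto simp: column_rows_def)
    fix y assume "y \<in> insert s (column_rows D c - {r})"
    then show "y \<le> top_row D c"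
      using m(4) le_top_row[OF D, of y c] le_top_row[OF D rc] by (auto simp: column_rows_def)
  qed
  ultimately show ?thesis by (auto simp: top_row_def cols)
qed

section \<open>Change of the excess under one move\<close>

lemma excess_le_kohnert_move:
  assumes D: "diagram D" and nt: "kohnert_move D r \<noteq> D"
  shows "excess D \<le> Suc (excess (kohnert_move D r))"
proof -
  obtain c where c: "(r, c) \<in> D" "\<And>c'. (r, c') \<in> D \<Longrightarrow> c' \<le> c"
    by (rule kohnert_moveE[OF D nt]) blast
  \<comment> \<open>The bounds are invariant, so only the summand of the moved cell's column
    \<open>c\<close> can change; the indicator of \<open>c\<close> absorbs a drop of its top by
    one.\<close>
  have "excess D \<le> (\<Sum>c' \<in> nonempty_columns D.
      (top_row (kohnert_move D r) c' - height_bound D c') + (if c' = c then 1 else 0))"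
    unfolding excess_def by (intro sum_mono) (auto simp: top_row_kohnert_move[OF D nt c])
  also have "\<dots> \<le> Suc (excess (kohnert_move D r))"
    using finite_nonempty_columns[OF D]
    by (simp add: excess_def sum.distrib nonempty_columns_kohnert_move[OF D]
        height_bound_kohnert_move[OF D] sum.delta)
  finally show ?thesis .
qed

lemma excess_pos_move:
  assumes D: "diagram D" and pos: "0 < excess D"
  obtains r where "0 < r" "kohnert_move D r \<noteq> D" "excess D = Suc (excess (kohnert_move D r))"
proof -
  let ?C = "{c \<in> nonempty_columns D. height_bound D c < top_row D c}"
  have fin: "finite ?C" using finite_nonempty_columns[OF D] by simp
  have ne: "?C \<noteq> {}"
  proof
    assume "?C = {}"
    then have "excess D = 0" by (auto simp: excess_def not_less)
    with pos show False by simp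
  qed
  \<comment> \<open>Taking the rightmost column with positive excess ensures that its top cell is
    the rightmost cell of its row.\<close>
  define c where "c = Max ?C"
  have "c \<in> ?C" using Max_in[OF fin ne] by (simp add: c_def)
  then have c: "c \<in> nonempty_columns D" "height_bound D c < top_row D c" by auto
  define r where "r = top_row D c"
  have rc: "(r, c) \<in> D" using top_row_in[OF D c(1)] by (simp add: r_def)
  have right: "c' \<le> c" if "(r, c') \<in> D" for c'
  proof (rule ccontr)
    assume "\<not> c' \<le> c"
    then have "c < c'" by simp
    have c': "c' \<in> nonempty_columns D"
      using that by (auto simp: nonempty_columns_def column_rows_def)
    \<comment> \<open>A cell of row \<open>r\<close> further right would lie in a column whose top
      is at least as high and whose bound is no larger, so that column would also have positive
      excess.\<close>
    have "height_bound D c' \<le> height_bound D c"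
      using height_bound_antimono[OF D c' \<open>c < c'\<close>] .
    moreover have "r \<le> top_row D c'" using le_top_row[OF D that] .
    ultimately have "c' \<in> ?C" using c c' by (simp add: r_def)
    then show False using Max_ge[OF fin] \<open>c < c'\<close> by (fastforce simp: c_def)
  qed
  \<comment> \<open>Column \<open>c\<close> has at most \<open>height_bound D c\<close> cells, hence
    fewer than \<open>r\<close>, which leaves a vacancy below its top.\<close>
  have "column_rows D c \<noteq> {1..r}"
    using c(2) by (auto simp: r_def height_bound_def)
  then obtain s where s: "s \<in> {1..r}" "s \<notin> column_rows D c"
    using column_rows_subset[OF D, of c] unfolding r_def by blast
  then have s': "0 < s" "s < r" "(s, c) \<notin> D"
    using rc by (auto simp: column_rows_def order_less_le)
  have nt: "kohnert_move D r \<noteq> D"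
    using kohnert_move_nontrivial[OF D rc right s'] by simp
  \<comment> \<open>Since the top of \<open>c\<close> lies strictly above its bound, truncation does
    not interfere and this summand drops by exactly one.\<close>
  have "excess D = (\<Sum>c' \<in> nonempty_columns D.
      (top_row (kohnert_move D r) c' - height_bound D c') + (if c' = c then 1 else 0))"
    unfolding excess_def using c(2)
    by (intro sum.cong refl) (auto simp: top_row_kohnert_move[OF D nt rc right] simp flip: r_def)
  also have "\<dots> = Suc (excess (kohnert_move D r))"
    using finite_nonempty_columns[OF D] c(1)
    by (simp add: excess_def sum.distrib nonempty_columns_kohnert_move[OF D]
        height_bound_kohnert_move[OF D] sum.delta)
  finally show thesis using that[of r] nt s' by simp
qed

lemma kohnert_move_trivial_if_excess_zero:
  assumes D: "diagram D" and zero: "excess D = 0"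
  shows "kohnert_move D r = D"
proof (rule ccontr)
  assume nt: "kohnert_move D r \<noteq> D"
  obtain s c where m: "(r, c) \<in> D" "(s, c) \<notin> D" "0 < s" "s < r"
      "\<And>c'. (r, c') \<in> D \<Longrightarrow> c' \<le> c"
    by (rule kohnert_moveE[OF D nt]) blast
  have le: "top_row D c' \<le> height_bound D c'" if "c' \<in> nonempty_columns D" for c'
    using zero that finite_nonempty_columns[OF D] by (simp add: excess_def)
  have c: "c \<in> nonempty_columns D"
    using m by (auto simp: nonempty_columns_def column_rows_def)
  have r: "r \<le> top_row D c" "0 < r" using le_top_row[OF D m(1)] m(4) by auto
  have not_full: "card (column_rows D c) < top_row D c"
  proof (rule ccontr)
    assume "\<not> ?thesis"
    then have "s \<in> column_rows D c" using column_full[OF D, of c] m(3,4) r by auto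
    with m(2) show False by (simp add: column_rows_def)
  qed
  \<comment> \<open>The column is too small to account for a bound that reaches its top, so larger
    columns to the right must do so. A nonzero \<open>right_max\<close> excludes the default value
    0, so the maximum is attained by an actual column.\<close>
  with le[OF c] have M: "height_bound D c = right_max D c" "right_max D c \<noteq> 0"
    by (auto simp: height_bound_def)
  \<comment> \<open>A column to the right with the largest number of cells is full, so it blocks row \<open>r\<close>.\<close>
  obtain c' where c': "c' \<in> nonempty_columns D" "c < c'" "right_max D c = card (column_rows D c')"
    using right_max_cases[OF D, of c] M(2) by metis
  \<comment> \<open>The top of \<open>c'\<close> is at most its own bound, which is at most the
    bound of \<open>c\<close>, which is the size of \<open>c'\<close>.\<close>
  have "top_row D c' \<le> card (column_rows D c')"
    using le[OF c'(1)] height_bound_antimono[OF D c'(1,2)] M(1) c'(3) by simp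
  then have "column_rows D c' = {1..top_row D c'}"
    using column_full[OF D, of c'] by simp
  moreover have "r \<le> top_row D c'"
    using r(1) le[OF c] M(1) c'(3) card_column_rows_le_top_row[OF D, of c'] by simp
  ultimately have "r \<in> column_rows D c'" using r(2) by auto
  then show False using m(5) c'(2) by (fastforce simp: column_rows_def)
qed

section \<open>Length of move sequences to a minimal diagram\<close>

lemma excess_le_length:
  assumes "diagram D" "nontrivial_moves D rs E" "\<forall>r>0. kohnert_move E r = E"
  shows "excess D \<le> length rs"
  using assms
proof (induction rs arbitrary: D)
  case Nil
  \<comment> \<open>Here \<open>D\<close> is fixed by every move, whereas a positive excess would
    yield a nontrivial one.\<close>
  have "excess D = 0"
    by (rule ccontr) (rule excess_pos_move[OF Nil.prems(1)], use Nil.prems in auto)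
  then show ?case by simp
next
  case (Cons r rs)
  then have "excess (kohnert_move D r) \<le> length rs" "kohnert_move D r \<noteq> D"
    using Cons.IH[OF diagram_kohnert_move] by auto
  then show ?case
    using excess_le_kohnert_move[OF Cons.prems(1), of r] by simp
qed

text \<open>Greedy strategy: repeat the moves of \<open>excess_pos_move\<close>, each lowering the
  excess by one, until it is 0 and the diagram is fixed by every move.\<close>

lemma exists_moves_of_length_excess:
  assumes "diagram D"
  shows "\<exists>E \<in> minimal_KD D. \<exists>rs. nontrivial_moves D rs E \<and> length rs = excess D"
  using assms
proof (induction "excess D" arbitrary: D)
  case 0
  then have "D \<in> minimal_KD D"
    by (simp add: minimal_KD_def KD_refl kohnert_move_trivial_if_excess_zero)
  then show ?case using 0 by (intro bexI[of _ D] exI[of _ "[]"]) auto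
next
  case (Suc k)
  then obtain r where r: "0 < r" "kohnert_move D r \<noteq> D"
      "excess D = Suc (excess (kohnert_move D r))"
    using excess_pos_move[of D] by auto
  then obtain E rs where E: "E \<in> minimal_KD (kohnert_move D r)"
      "nontrivial_moves (kohnert_move D r) rs E" "length rs = excess (kohnert_move D r)"
    using Suc.hyps(1)[of "kohnert_move D r"] Suc.hyps(2) diagram_kohnert_move[OF Suc.prems] by auto
  have "E \<in> minimal_KD D"
    using E(1) KD_trans[OF _ KD_step[OF KD_refl r(1)]] by (auto simp: minimal_KD_def)
  then show ?case using E r by (intro bexI[of _ E] exI[of _ "r # rs"]) auto
qed

lemma mc_eq_excess:
  assumes "diagram D" shows "mc D = excess D"
  unfolding mc_def
proof (rule Least_equality)
  show "\<exists>E \<in> minimal_KD D. \<exists>rs. nontrivial_moves D rs E \<and> length rs = excess D"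
    using exists_moves_of_length_excess[OF assms] .
qed (use excess_le_length[OF assms] in \<open>auto simp: minimal_KD_def\<close>)

theorem theorem4p1:
  fixes D :: "cell set" and n :: nat and c r :: "nat \<Rightarrow> nat"
  assumes "diagram D"
    and "strict_mono_on {1..n} c"
    and "c ` {1..n} = nonempty_columns D"
    and "\<And>i. i \<in> {1..n} \<Longrightarrow> r i = top_row D (c i)"
  shows "int (mc D) = (\<Sum>i = 1..n. int (r i) - int (h D (c i)))"
proof -
  have inj: "inj_on c {1..n}" using assms(2) by (rule strict_mono_on_imp_inj_on)
  \<comment> \<open>Because \<open>h D c\<close> is the minimum of top and bound, the truncated
    difference of top and bound equals the integer difference of the top and
    \<open>h D c\<close>.\<close>
  have "int (mc D) = (\<Sum>c \<in> nonempty_columns D. int (top_row D c) - int (h D c))"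
    by (simp add: mc_eq_excess[OF assms(1)] excess_def h_eq[OF assms(1)] min_def)
      (intro sum.cong refl, auto)
  also have "\<dots> = (\<Sum>i = 1..n. int (top_row D (c i)) - int (h D (c i)))"
    by (simp only: sum.reindex[OF inj] o_def flip: assms(3))
  also have "\<dots> = (\<Sum>i = 1..n. int (r i) - int (h D (c i)))"
    by (intro sum.cong refl) (simp add: assms(4))
  finally show ?thesis .
qed

end
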